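(* Let $\lambda=(\lambda_1\ge\dots\ge\lambda_n\ge0)$ be a partition with $n$ parts, $\tau\in S_n$, and let $F\in\mathrm{InvFree}(\tau\lambda,\tau w_0)$. Then $\mathrm{cocharge}(\mathrm{ccw}(F))=\mathrm{maj}(F)$.
   Context: For $\tau\in S_n$ and a sequence $a=(a_1,\dots,a_n)$, $\tau a=(a_{\tau^{-1}(1)},\dots,a_{\tau^{-1}(n)})$; $w_0=(n,n-1,\dots,1)$, so $\tau w_0=(n+1-\tau^{-1}(1),\dots,n+1-\tau^{-1}(n))$. Big basements: symbols $\infty_1,\dots,\infty_n$ with $\infty_i<\infty_j$ iff $i<j$ and $\infty_i>m$ for every positive integer $m$. For a composition $\alpha$ and permutation sequence $\sigma$, the augmented diagram of shape $\alpha$ has rows $1,\dots,n$ top to bottom, row $r$ consisting of boxes $(r,0),\dots,(r,\alpha_r)$, column $0$ the basement; a filling with big basement $\sigma$ has $F(r,0)=\infty_{\sigma_r}$ and positive integers elsewhere. A type $A$ triple is $a=(r,j-1)$, $b=(r,j)$, $c=(k,j)$ with $j\ge1$, $k>r$, $\alpha_r\ge\alpha_k$; a type $B$ triple is $a=(r,j-1)$, $b=(r,j)$, $c=(k,j-1)$ with $j\ge1$, $k<r$, $\alpha_r>\alpha_k$. Compare by value, ties broken with $a$ largest, then $c$, then $b$. A type $A$ (resp. $B$) triple is an inversion triple if its entries in increasing order form a cyclic rotation of $(a,c,b)$ (resp. $(c,b,a)$). $\mathrm{InvFree}(\alpha,\sigma)$: fillings with no inversion triples. $\mathrm{maj}(F)=\sum(\mathrm{leg}(b)+1)$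 over non-basement boxes $b$ with $F(a)<F(b)$, $a$ the box immediately left of $b$, $\mathrm{leg}(b)$ the number of boxes to the right of $b$ in its row. Cocharge word: number the non-basement columns $1,2,\dots$ from left to right. Form a two-line array whose top row lists the non-basement entries of $F$ in weakly decreasing order and whose bottom row gives the column of each entry, with column numbers listed in increasing order among equal top entries. $\mathrm{ccw}(F)$ is the bottom row. Cocharge: for a word whose content is a partition, extract standard subwords iteratively: take the rightmost $1$, then scanning leftwards cyclically (wrapping from the left end to the right end) the first $2$, then continuing leftwards cyclically the first $3$, etc., up to the largest letter present; the chosen letters in their order in the word form a permutation $u$; remove them and repeat. For a permutation $u$ of $1,\dots,m$, assign index $0$ to the letter $1$, and for $r<m$ give $r+1$ the index of $r$ plus $1$ if $r+1$ appears to the left of $r$ in $u$, and the same index as $r$ otherwise; $\mathrm{cocharge}(u)$ is the sum of the indices (equivalently $\binom m2-\mathrm{maj}(\mathrm{reverse}(u^{-1}))$). The cocharge of the word is the sum over its standard subwords. *)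

theory Defs
  imports "HOL-Combinatorics.Permutations" "HOL-Library.FuncSet" "HOL-Library.Multiset"
begin

text \<open>
  A sequence \<open>(a\<^sub>1, \<dots>, a\<^sub>n)\<close> is a function on \<open>nat\<close> of which only the values on \<open>{1..n}\<close> matter.
\<close>

definition perm_act :: "(nat \<Rightarrow> nat) \<Rightarrow> (nat \<Rightarrow> 'a) \<Rightarrow> nat \<Rightarrow> 'a" where
  "perm_act \<tau> a = (\<lambda>i. a (inv \<tau> i))"

definition w0 :: "nat \<Rightarrow> nat \<Rightarrow> nat" where
  "w0 n = (\<lambda>i. n + 1 - i)"


subsection \<open>Fillings with big basements\<close>

datatype entry = Num nat | Infty nat

instantiation entry :: linorder
begin

fun less_entry :: "entry \<Rightarrow> entry \<Rightarrow> bool" where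
  "less_entry (Num x) (Num y) \<longleftrightarrow> x < y"
| "less_entry (Num x) (Infty j) \<longleftrightarrow> True"
| "less_entry (Infty i) (Num y) \<longleftrightarrow> False"
| "less_entry (Infty i) (Infty j) \<longleftrightarrow> i < j"

definition less_eq_entry :: "entry \<Rightarrow> entry \<Rightarrow> bool" where
  "less_eq_entry x y \<longleftrightarrow> x < y \<or> x = y"

instance
proof
  fix x y z :: entry
  show "x < y \<longleftrightarrow> x \<le> y \<and> \<not> y \<le> x"
    by (cases x; cases y) (auto simp: less_eq_entry_def)
  show "x \<le> x"
    by (simp add: less_eq_entry_def)
  show "x \<le> y \<Longrightarrow> y \<le> z \<Longrightarrow> x \<le> z"
    by (cases x; cases y; cases z) (auto simp: less_eq_entry_def)
  show "x \<le> y \<Longrightarrow> y \<le> x \<Longrightarrow> x = y"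
    by (cases x; cases y) (auto simp: less_eq_entry_def)
  show "x \<le> y \<or> y \<le> x"
    by (cases x; cases y) (auto simp: less_eq_entry_def)
qed

end

text \<open>The box \<open>(r, j)\<close> lies in row \<open>r\<close>, counted from the top, and in column \<open>j\<close>.\<close>

type_synonym box = "nat \<times> nat"

definition aug_diagram :: "nat \<Rightarrow> (nat \<Rightarrow> nat) \<Rightarrow> box set" where
  "aug_diagram n \<alpha> = {(r, j). r \<in> {1..n} \<and> j \<le> \<alpha> r}"

definition diagram :: "nat \<Rightarrow> (nat \<Rightarrow> nat) \<Rightarrow> box set" where
  "diagram n \<alpha> = {(r, j) \<in> aug_diagram n \<alpha>. j \<ge> 1}"

definition fillings :: "nat \<Rightarrow> (nat \<Rightarrow> nat) \<Rightarrow> (nat \<Rightarrow> nat) \<Rightarrow> (box \<Rightarrow> entry) set" where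
  "fillings n \<alpha> \<sigma> = {F \<in> extensional (aug_diagram n \<alpha>).
     (\<forall>r\<in>{1..n}. F (r, 0) = Infty (\<sigma> r)) \<and>
     (\<forall>b\<in>diagram n \<alpha>. \<exists>m\<ge>1. F b = Num m)}"

definition typeA_triples :: "nat \<Rightarrow> (nat \<Rightarrow> nat) \<Rightarrow> (box \<times> box \<times> box) set" where
  "typeA_triples n \<alpha> = {((r, j - 1), (r, j), (k, j)) | r k j.
     j \<ge> 1 \<and> k > r \<and> \<alpha> r \<ge> \<alpha> k \<and> (r, j) \<in> aug_diagram n \<alpha> \<and> (k, j) \<in> aug_diagram n \<alpha>}"

definition typeB_triples :: "nat \<Rightarrow> (nat \<Rightarrow> nat) \<Rightarrow> (box \<times> box \<times> box) set" where
  "typeB_triples n \<alpha> = {((r, j - 1), (r, j), (k, j - 1)) | r k j.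
     j \<ge> 1 \<and> k < r \<and> \<alpha> r > \<alpha> k \<and> (r, j) \<in> aug_diagram n \<alpha> \<and> (k, j - 1) \<in> aug_diagram n \<alpha>}"

text \<open>
  Entries are compared together with a priority that breaks ties: among equal entries of a
  triple \<open>(a, b, c)\<close>, the one in \<open>a\<close> (priority \<open>2\<close>) is the largest, then that in \<open>c\<close> (priority \<open>1\<close>),
  then that in \<open>b\<close> (priority \<open>0\<close>).
\<close>

fun tie_less :: "entry \<times> nat \<Rightarrow> entry \<times> nat \<Rightarrow> bool" where
  "tie_less (x, p) (y, q) \<longleftrightarrow> x < y \<or> x = y \<and> p < q"

definition inversion_typeA :: "(box \<Rightarrow> entry) \<Rightarrow> box \<times> box \<times> box \<Rightarrow> bool" where
  "inversion_typeA F = (\<lambda>(a, b, c).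
     \<exists>i. sorted_wrt tie_less (rotate i [(F a, 2), (F c, 1), (F b, 0)]))"

definition inversion_typeB :: "(box \<Rightarrow> entry) \<Rightarrow> box \<times> box \<times> box \<Rightarrow> bool" where
  "inversion_typeB F = (\<lambda>(a, b, c).
     \<exists>i. sorted_wrt tie_less (rotate i [(F c, 1), (F b, 0), (F a, 2)]))"

definition inv_free :: "nat \<Rightarrow> (nat \<Rightarrow> nat) \<Rightarrow> (nat \<Rightarrow> nat) \<Rightarrow> (box \<Rightarrow> entry) set" where
  "inv_free n \<alpha> \<sigma> = {F \<in> fillings n \<alpha> \<sigma>.
     (\<forall>t\<in>typeA_triples n \<alpha>. \<not> inversion_typeA F t) \<and>
     (\<forall>t\<in>typeB_triples n \<alpha>. \<not> inversion_typeB F t)}"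

definition leg :: "(nat \<Rightarrow> nat) \<Rightarrow> box \<Rightarrow> nat" where
  "leg \<alpha> = (\<lambda>(r, j). \<alpha> r - j)"

definition maj :: "nat \<Rightarrow> (nat \<Rightarrow> nat) \<Rightarrow> (box \<Rightarrow> entry) \<Rightarrow> nat" where
  "maj n \<alpha> F = (\<Sum>(r, j) \<in> {(r, j) \<in> diagram n \<alpha>. F (r, j - 1) < F (r, j)}. leg \<alpha> (r, j) + 1)"


subsection \<open>Cocharge words\<close>

text \<open>
  The two-line array is the list of its columns. Since \<open>sort_key\<close> is stable, the outer sort keeps
  equal top entries in the order of decreasing bottom entries, and \<open>rev\<close> reverses both orders;
  see the characterization in \<open>two_line_array_unique\<close> below.
\<close>

definition two_line_array :: "nat \<Rightarrow> (nat \<Rightarrow> nat) \<Rightarrow> (box \<Rightarrow> entry) \<Rightarrow> (entry \<times> nat) list" where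
  "two_line_array n \<alpha> F = rev (sort_key fst (rev (sort_key snd
     [(F (r, j), j). r \<leftarrow> [1..<Suc n], j \<leftarrow> [1..<Suc (\<alpha> r)]])))"

definition ccw :: "nat \<Rightarrow> (nat \<Rightarrow> nat) \<Rightarrow> (box \<Rightarrow> entry) \<Rightarrow> nat list" where
  "ccw n \<alpha> F = map snd (two_line_array n \<alpha> F)"

definition array_le :: "entry \<times> nat \<Rightarrow> entry \<times> nat \<Rightarrow> bool" where
  "array_le = (\<lambda>(x, i) (y, j). y < x \<or> x = y \<and> i \<le> j)"

lemma mset_two_line_array:
  "mset (two_line_array n \<alpha> F) = image_mset (\<lambda>(r, j). (F (r, j), j)) (mset_set (diagram n \<alpha>))"
proof -
  let ?bs = "[(r, j). r \<leftarrow> [1..<Suc n], j \<leftarrow> [1..<Suc (\<alpha> r)]]"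
  have set: "set ?bs = diagram n \<alpha>"
    by (simp add: diagram_def aug_diagram_def set_eq_iff image_iff del: upt_Suc) auto
  have "distinct (concat (map (\<lambda>r. map (Pair r) [1..<Suc (\<alpha> r)]) xs))" if "distinct xs" for xs
    using that by (induction xs) (auto simp: distinct_map inj_on_def)
  hence "distinct ?bs"
    by simp
  hence bs: "mset ?bs = mset_set (diagram n \<alpha>)"
    using mset_set_set[of ?bs] set by simp
  have "[(F (r, j), j). r \<leftarrow> [1..<Suc n], j \<leftarrow> [1..<Suc (\<alpha> r)]] = map (\<lambda>(r, j). (F (r, j), j)) ?bs"
    by (simp add: map_concat o_def del: upt_Suc)
  thus ?thesis
    unfolding two_line_array_def by (simp add: bs[symmetric] del: upt_Suc)
qed

lemma sorted_two_line_array: "sorted_wrt array_le (two_line_array n \<alpha> F)"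
proof -
  have "sorted_wrt (\<lambda>p q. fst p < fst q \<or> fst p = fst q \<and> snd q \<le> snd p) (sort_key fst xs)"
    if "sorted_wrt (\<lambda>p q. snd q \<le> snd p) xs" for xs :: "(entry \<times> nat) list"
  proof -
    have ins: "sorted_wrt (\<lambda>p q. fst p < fst q \<or> fst p = fst q \<and> snd q \<le> snd p) (insort_key fst x ys)"
      if "sorted_wrt (\<lambda>p q. fst p < fst q \<or> fst p = fst q \<and> snd q \<le> snd p) ys"
        and "\<forall>y\<in>set ys. snd y \<le> snd x"
      for x and ys :: "(entry \<times> nat) list"
      using that
    proof (induction ys)
      case (Cons y ys)
      show ?case
      proof (cases "fst x \<le> fst y")
        case True
        thus ?thesis
          using Cons.prems by (fastforce simp: le_less)
      next
        case False
        thus ?thesis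
          using Cons by (auto simp: set_insort_key)
      qed
    qed simp
    show ?thesis
      using that by (induction xs) (auto intro!: ins)
  qed
  moreover have "sorted_wrt (\<lambda>p q. snd q \<le> snd p) (rev (sort_key snd xs))"
    for xs :: "(entry \<times> nat) list"
    using sorted_sort_key[of snd xs] by (simp add: sorted_wrt_rev sorted_map)
  ultimately have "sorted_wrt (\<lambda>p q. fst p < fst q \<or> fst p = fst q \<and> snd q \<le> snd p)
      (rev (two_line_array n \<alpha> F))"
    unfolding two_line_array_def by simp
  hence "sorted_wrt (\<lambda>p q. array_le q p) (rev (two_line_array n \<alpha> F))"
    by (rule sorted_wrt_mono_rel[rotated]) (auto simp: array_le_def)
  thus ?thesis
    by (simp add: sorted_wrt_rev)
qed

lemma two_line_array_unique:
  "xs = two_line_array n \<alpha> F \<longleftrightarrow>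
     mset xs = image_mset (\<lambda>(r, j). (F (r, j), j)) (mset_set (diagram n \<alpha>)) \<and>
     sorted_wrt array_le xs"
proof -
  have "xs = ys" if "mset xs = mset ys" "sorted_wrt array_le xs" "sorted_wrt array_le ys" for xs ys
    using that
  proof (induction xs arbitrary: ys)
    case (Cons x xs)
    then obtain y ys' where ys: "ys = y # ys'"
      by (cases ys) auto
    have "x \<in> set ys" "y \<in> set (x # xs)"
      using Cons.prems(1) ys by (metis list.set_intros(1) set_mset_mset)+
    hence "x = y \<or> array_le x y \<and> array_le y x"
      using Cons.prems(2,3) ys by auto
    hence "x = y"
      by (cases x; cases y) (auto simp: array_le_def)
    thus ?case
      using Cons ys by auto
  qed auto
  thus ?thesis
    using mset_two_line_array sorted_two_line_array by metis
qed


subsection \<open>Cocharge\<close>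

text \<open>
  Positions in a word are numbered from \<open>0\<close>. \<open>scan_left w p x\<close> is the position of the first \<open>x\<close>
  met when scanning \<open>w\<close> cyclically leftwards, starting immediately to the left of position \<open>p\<close>;
  it is only meaningful if \<open>x\<close> occurs in \<open>w\<close>.
\<close>

definition scan_left :: "nat list \<Rightarrow> nat \<Rightarrow> nat \<Rightarrow> nat" where
  "scan_left w p x =
     (if \<exists>q<p. w ! q = x then Max {q \<in> {..<p}. w ! q = x}
      else Max {q \<in> {..<length w}. w ! q = x})"

text \<open>
  The position of the letter \<open>i \<ge> 1\<close> of the first standard subword. The scan starts at the right
  end of the word, so that the letter \<open>1\<close> is the rightmost one.
\<close>

primrec std_pos :: "nat list \<Rightarrow> nat \<Rightarrow> nat" where
  "std_pos w 0 = length w"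
| "std_pos w (Suc i) = scan_left w (std_pos w i) (Suc i)"

definition std_positions :: "nat list \<Rightarrow> nat set" where
  "std_positions w = std_pos w ` {1..Max (set w)}"

definition std_subword :: "nat list \<Rightarrow> nat list" where
  "std_subword w = nths w (std_positions w)"

definition std_remainder :: "nat list \<Rightarrow> nat list" where
  "std_remainder w = nths w (- std_positions w)"

definition left_of :: "nat list \<Rightarrow> nat \<Rightarrow> nat \<Rightarrow> bool" where
  "left_of u x y \<longleftrightarrow> (\<exists>q<length u. \<exists>p<q. u ! p = x \<and> u ! q = y)"

text \<open>The index of the letter \<open>r \<ge> 1\<close> of a permutation; the value at \<open>0\<close> is a dummy.\<close>

fun cocharge_index :: "nat list \<Rightarrow> nat \<Rightarrow> nat" where
  "cocharge_index u 0 = 0"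
| "cocharge_index u (Suc 0) = 0"
| "cocharge_index u (Suc (Suc r)) =
     cocharge_index u (Suc r) + (if left_of u (Suc (Suc r)) (Suc r) then 1 else 0)"

definition cocharge_perm :: "nat list \<Rightarrow> nat" where
  "cocharge_perm u = (\<Sum>r = 1..length u. cocharge_index u r)"

lemma length_std_remainder:
  assumes "1 \<in> set w"
  shows "length (std_remainder w) < length w"
proof -
  let ?S = "{q \<in> {..<length w}. w ! q = 1}"
  obtain q where q: "q < length w" "w ! q = 1"
    using assms by (auto simp: in_set_conv_nth)
  hence "Max ?S \<in> ?S"
    by (intro Max_in) auto
  moreover have "std_pos w 1 = Max ?S"
    using q by (auto simp: scan_left_def)
  moreover have "1 \<le> Max (set w)"
    using assms by simp
  ultimately have "std_pos w 1 < length w" "1 \<in> {1..Max (set w)}"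
    by simp_all
  hence "std_pos w 1 < length w" "std_pos w 1 \<in> std_positions w"
    unfolding std_positions_def by blast+
  hence "{i. i < length w \<and> i \<in> - std_positions w} \<subset> {..<length w}"
    by auto
  hence "card {i. i < length w \<and> i \<in> - std_positions w} < card {..<length w}"
    by (rule psubset_card_mono[rotated]) simp
  thus ?thesis
    by (simp add: std_remainder_def length_nths)
qed

text \<open>
  A word whose content is a partition (all letters positive, and each \<open>i + 1\<close> occurring at most
  as often as \<open>i\<close>) contains the letter \<open>1\<close> unless it is empty; removing a standard subword preserves
  this property. The value \<open>0\<close> for other words without a \<open>1\<close> is a dummy.
\<close>

function cocharge :: "nat list \<Rightarrow> nat" where
  "cocharge w = (if 1 \<in> set w then cocharge_perm (std_subword w) + cocharge (std_remainder w) else 0)"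
  by auto
termination
  by (relation "measure length") (auto simp: length_std_remainder)

declare cocharge.simps [simp del]

end

theory Submission
  imports Defs
begin

text \<open>
  Triples of both types are non-inversions exactly when \<open>a, b, c\<close> are cyclically increasing, so being
  inversion-free is a condition on pairs of rows. It determines how to exchange a row with a
  longer row directly below it: from left to right, the long row takes from each column of the pair
  the entry met first when going upwards cyclically from its previous entry. This keeps the content
  of every column, the major index and the conditions with all other rows. Hence a longest row can be
  moved to the top. There it meets in each column the first entry, among all rows, after its previous
  one; so it is the first standard subword of the cocharge word, its ascents are the places where
  the cocharge index increases, and the theorem follows by induction on the number of rows.
\<close>

subsection \<open>Cyclic order\<close>

text \<open>Going cyclically upwards from \<open>a\<close>, the value \<open>b\<close> is met no later than \<open>c\<close>; the value \<open>a\<close> itself is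
  met last.\<close>

definition cyc :: "'a::linorder \<Rightarrow> 'a \<Rightarrow> 'a \<Rightarrow> bool" where
  "cyc a b c \<longleftrightarrow> a < b \<and> b \<le> c \<or> b \<le> c \<and> c \<le> a \<or> c \<le> a \<and> a < b"

lemma not_cyc_iff: "\<not> cyc a b c \<longleftrightarrow> a < c \<and> c < b \<or> c < b \<and> b \<le> a \<or> b \<le> a \<and> a < c"
  by (auto simp: cyc_def)

lemma cyc_refl [simp]: "cyc a b b"
  by (auto simp: cyc_def)

lemma cyc_total: "\<not> cyc a b c \<Longrightarrow> cyc a c b"
  by (auto simp: cyc_def)

abbreviation asc :: "'a::linorder \<Rightarrow> 'a \<Rightarrow> nat" where
  "asc a b \<equiv> of_bool (a < b)"

text \<open>In the next three lemmas \<open>x, X\<close> and \<open>y, Y\<close> are consecutive entries of a row and of the longer row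
  directly below it, and \<open>c\<close> and \<open>d\<close> are entries of a third row. The long row of the exchanged pair
  moves from \<open>y\<close> to \<open>X\<close> in \<open>cyc_enter\<close> and from \<open>x\<close> to \<open>Y\<close> in \<open>cyc_leave\<close>; in \<open>cyc_cross\<close> it starts at \<open>x\<close>.\<close>

lemma cyc_enter:
  fixes x y X Y :: "'a::linorder"
  assumes "cyc y Y x" "\<not> cyc y Y X"
  shows "cyc x X c \<Longrightarrow> cyc y Y c \<Longrightarrow> cyc y X c"
    and "cyc x X c \<Longrightarrow> cyc y Y c \<Longrightarrow> cyc x Y c"
    and "asc y X + asc x Y = asc x X + asc y Y"
    and "asc y X = asc y Y + asc Y X"
    and "cyc y Y c \<Longrightarrow> cyc y X c"
    and "cyc y Y c \<Longrightarrow> cyc c d X \<Longrightarrow> cyc c d Y"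
    and "cyc y Y c \<Longrightarrow> cyc c d X \<Longrightarrow> \<not> cyc X d Y"
    and "cyc y Y c \<Longrightarrow> cyc X Y c"
    and "cyc y Y c \<Longrightarrow> c \<noteq> X"
  using assms unfolding not_cyc_iff unfolding cyc_def
  by (elim disjE conjE; ((simp; fail) | auto))+

lemma cyc_leave:
  fixes x y X Y :: "'a::linorder"
  assumes "cyc y Y x" "x \<noteq> y" "cyc x Y X"
  shows "cyc x X c \<Longrightarrow> cyc y Y c \<Longrightarrow> cyc x Y c"
    and "cyc x X c \<Longrightarrow> cyc y Y c \<Longrightarrow> cyc y X c"
    and "asc x Y + asc y X = asc x X + asc y Y"
  using assms unfolding cyc_def
  by (elim disjE conjE; ((simp; fail) | auto))+

lemma cyc_cross:
  fixes x y X Y :: "'a::linorder"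
  assumes "cyc y Y x" "x \<noteq> y"
  shows "asc x Y + asc y x = asc y Y"
    and "\<not> cyc x Y X \<Longrightarrow> asc x X + asc y x = asc y Y + asc Y X"
    and "cyc y Y c \<Longrightarrow> \<not> cyc x c y \<Longrightarrow> cyc x Y c"
    and "cyc y Y c \<Longrightarrow> \<not> cyc x c y \<Longrightarrow> \<not> cyc x Y X \<Longrightarrow> cyc x X c"
    and "cyc y Y c \<Longrightarrow> \<not> cyc x c y \<Longrightarrow> \<not> cyc x Y X \<Longrightarrow> cyc c d X \<Longrightarrow> cyc c d Y"
    and "cyc y Y c \<Longrightarrow> \<not> cyc x c y \<Longrightarrow> \<not> cyc x Y X \<Longrightarrow> cyc c d X \<Longrightarrow> \<not> cyc X d Y"
    and "cyc x y c \<Longrightarrow> c \<noteq> x \<Longrightarrow> cyc c d x \<Longrightarrow> cyc c d y"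
    and "cyc x y c \<Longrightarrow> c \<noteq> x \<Longrightarrow> cyc c d x \<Longrightarrow> cyc y Y d \<Longrightarrow> cyc x Y d"
    and "cyc x y c \<Longrightarrow> c \<noteq> x \<Longrightarrow> cyc c d x \<Longrightarrow> cyc y Y d \<Longrightarrow> \<not> cyc x Y X \<Longrightarrow> cyc x X d"
    and "cyc x y c \<Longrightarrow> c \<noteq> x \<Longrightarrow> cyc c d x \<Longrightarrow> cyc y Y d \<Longrightarrow> \<not> cyc x Y X \<Longrightarrow> cyc X Y d"
    and "cyc x y c \<Longrightarrow> c \<noteq> x \<Longrightarrow> cyc c d x \<Longrightarrow> cyc y Y d \<Longrightarrow> \<not> cyc x Y X \<Longrightarrow> d \<noteq> X"
  using assms unfolding not_cyc_iff unfolding cyc_def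
  by (elim disjE conjE; ((simp; fail) | auto))+

section \<open>Rows, their compatibility and their statistics\<close>

type_synonym 'a row = "nat \<times> (nat \<Rightarrow> 'a)"

text \<open>The row \<open>(p, x)\<close> has entries \<open>x 1, \<dots>, x p\<close> and basement entry \<open>x 0\<close>. The first row is the upper one;
  the two cases are the triples of type A and type B.\<close>

fun row_compat :: "'a::linorder row \<Rightarrow> 'a row \<Rightarrow> bool" where
  "row_compat (p, x) (q, y) \<longleftrightarrow>
     (if q \<le> p then \<forall>j<q. cyc (x j) (x (Suc j)) (y (Suc j))
      else \<forall>j\<le>p. cyc (y j) (y (Suc j)) (x j))"

text \<open>The weight \<open>p - j\<close> is the leg of the box in column \<open>Suc j\<close>,
  plus one.\<close>

fun row_maj :: "'a::linorder row \<Rightarrow> nat" where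
  "row_maj (p, x) = (\<Sum>j<p. (p - j) * asc (x j) (x (Suc j)))"

fun cells :: "'a row \<Rightarrow> ('a \<times> nat) multiset" where
  "cells (p, x) = (\<Sum>j\<in>{1..p}. {#(x j, j)#})"

subsection \<open>Exchanging two rows\<close>

text \<open>\<open>cross x y j\<close> holds if, in column \<open>j\<close>, the long row of the exchanged pair takes its entry
  from \<open>x\<close>.\<close>

primrec cross :: "(nat \<Rightarrow> 'a::linorder) \<Rightarrow> (nat \<Rightarrow> 'a) \<Rightarrow> nat \<Rightarrow> bool" where
  "cross x y 0 \<longleftrightarrow> False"
| "cross x y (Suc j) \<longleftrightarrow> \<not> cyc (if cross x y j then x j else y j) (y (Suc j)) (x (Suc j))"

text \<open>The guard \<open>j \<le> p\<close> cuts off \<open>cross\<close>, which beyond the short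
  row compares with meaningless values of \<open>x\<close>.\<close>

definition long_row :: "nat \<Rightarrow> (nat \<Rightarrow> 'a::linorder) \<Rightarrow> (nat \<Rightarrow> 'a) \<Rightarrow> nat \<Rightarrow> 'a" where
  "long_row p x y j = (if j \<le> p \<and> cross x y j then x j else y j)"

definition short_row :: "(nat \<Rightarrow> 'a::linorder) \<Rightarrow> (nat \<Rightarrow> 'a) \<Rightarrow> nat \<Rightarrow> 'a" where
  "short_row x y j = (if cross x y j then y j else x j)"

text \<open>Ties go to \<open>y\<close> by \<open>cyc_refl\<close>. This supplies the hypothesis
  \<open>x \<noteq> y\<close> of \<open>cyc_leave\<close> and \<open>cyc_cross\<close>.\<close>

lemma cross_neq: "cross x y j \<Longrightarrow> x j \<noteq> y j"
  by (cases j) auto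

text \<open>In every column of the pair the long row takes the cyclically first entry, which is the
  type A condition.\<close>

lemma compat_swapped:
  assumes "p < q"
  shows "row_compat (q, long_row p x y) (p, short_row x y)"
  using assms by (auto simp: long_row_def short_row_def dest: cyc_total)

lemma cells_swapped:
  assumes "p < q"
  shows "cells (q, long_row p x y) + cells (p, short_row x y) = cells (p, x) + cells (q, y)"
proof -
  have split: "{1..q} = {1..p} \<union> {Suc p..q}"
    using assms by auto
  have cells_q: "cells (q, f) = cells (p, f) + (\<Sum>j\<in>{Suc p..q}. {#(f j, j)#})" for f :: "nat \<Rightarrow> 'a"
    unfolding cells.simps split by (rule sum.union_disjoint) auto
  have "cells (p, long_row p x y) + cells (p, short_row x y) = cells (p, x) + cells (p, y)"
    unfolding cells.simps sum.distrib[symmetric]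
    by (rule sum.cong) (auto simp: long_row_def short_row_def)
  moreover have "(\<Sum>j\<in>{Suc p..q}. {#(long_row p x y j, j)#}) = (\<Sum>j\<in>{Suc p..q}. {#(y j, j)#})"
    by (rule sum.cong) (auto simp: long_row_def)
  moreover have "a + t + b = c + (d + t)" if "a + b = c + d" for a b c d t :: "('a \<times> nat) multiset"
    using that by (metis add.assoc add.commute)
  ultimately show ?thesis
    by (simp only: cells_q[of "long_row p x y"] cells_q[of y])
qed

text \<open>For \<open>j \<le> p\<close> the weight \<open>q - j\<close> splits into
  \<open>p - j\<close> and \<open>q - p\<close>. The parts with weight \<open>p - j\<close> balance
  against the short row step by step; those with weight \<open>q - p\<close> agree because the long
  row keeps its number of ascents up to column \<open>Suc p\<close>.\<close>

lemma row_maj_swapped: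
  assumes "row_compat (p, x) (q, y)" "p < q"
  shows "row_maj (q, long_row p x y) + row_maj (p, short_row x y) = row_maj (p, x) + row_maj (q, y)"
proof -
  let ?u = "long_row p x y" and ?v = "short_row x y"
  let ?a = "\<lambda>f j. asc (f j) (f (Suc j))"
  have B: "cyc (y j) (y (Suc j)) (x j)" if "j \<le> p" for j
    using assms that by simp
  \<comment> \<open>Only switching steps change anything: \<open>cyc_enter\<close> covers those from
    \<open>y\<close> to \<open>x\<close>, \<open>cyc_leave\<close> those back.\<close>
  have both: "?a ?u j + ?a ?v j = ?a x j + ?a y j" if "j < p" for j
    using that cyc_enter(3)[OF B, of j "x (Suc j)"] cyc_leave(3)[OF B, of j "x (Suc j)"] cross_neq[of x y j]
    by (auto simp: long_row_def short_row_def simp del: of_bool_eq)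
  \<comment> \<open>In the crossed state the new long row lags behind \<open>y\<close> by less than one turn of the cycle, so the
    numbers of ascents differ only by the position of the turning point.\<close>
  have partial: "(\<Sum>j<k. ?a ?u j) = (\<Sum>j<k. ?a y j) + (if cross x y k then asc (y k) (x k) else 0)"
    if "k \<le> p" for k
    using that
  proof (induction k)
    case (Suc k)
    then have "?a ?u k + (if cross x y k then asc (y k) (x k) else 0)
      = ?a y k + (if cross x y (Suc k) then asc (y (Suc k)) (x (Suc k)) else 0)"
      using cyc_enter(4)[OF B, of k "x (Suc k)"] cyc_cross(1)[OF B, of k] cyc_cross(2)[OF B, of k "x (Suc k)"]
        cross_neq[of x y k]
      by (auto simp: long_row_def simp del: of_bool_eq)
    with Suc show ?case
      by simp
  qed simp
  \<comment> \<open>In column \<open>Suc p\<close> the long row is back on \<open>y\<close>, which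
    absorbs the correction term.\<close>
  have "?a ?u p + (if cross x y p then asc (y p) (x p) else 0) = ?a y p"
    using cyc_cross(1)[OF B, of p] cross_neq[of x y p]
    by (auto simp: long_row_def simp del: of_bool_eq)
  with partial[of p] have long: "(\<Sum>j<Suc p. ?a ?u j) = (\<Sum>j<Suc p. ?a y j)"
    unfolding sum.lessThan_Suc by linarith
  have expand: "row_maj (q, f) = (\<Sum>j<p. (p - j) * ?a f j) + (q - p) * (\<Sum>j<Suc p. ?a f j)
      + (\<Sum>j\<in>{Suc p..<q}. (q - j) * ?a f j)" for f :: "nat \<Rightarrow> 'a"
  proof -
    have split: "{..<q} = {..<Suc p} \<union> {Suc p..<q}"
      using assms(2) by auto
    have "row_maj (q, f) = (\<Sum>j<Suc p. (q - j) * ?a f j) + (\<Sum>j\<in>{Suc p..<q}. (q - j) * ?a f j)"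
      unfolding row_maj.simps split by (rule sum.union_disjoint) auto
    also have "(\<Sum>j<Suc p. (q - j) * ?a f j) = (\<Sum>j<Suc p. (p - j) * ?a f j + (q - p) * ?a f j)"
      using assms(2) by (intro sum.cong) (auto simp: add_mult_distrib[symmetric] simp del: of_bool_eq)
    finally show ?thesis
      by (simp add: sum.distrib sum_distrib_left)
  qed
  have tail: "(\<Sum>j\<in>{Suc p..<q}. (q - j) * ?a ?u j) = (\<Sum>j\<in>{Suc p..<q}. (q - j) * ?a y j)"
    by (rule sum.cong) (auto simp: long_row_def)
  have "(\<Sum>j<p. (p - j) * ?a ?u j) + row_maj (p, ?v) = (\<Sum>j<p. (p - j) * (?a ?u j + ?a ?v j))"
    by (simp add: sum.distrib add_mult_distrib2)
  also have "\<dots> = (\<Sum>j<p. (p - j) * (?a x j + ?a y j))"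
    using both by (intro sum.cong) auto
  also have "\<dots> = row_maj (p, x) + (\<Sum>j<p. (p - j) * ?a y j)"
    by (simp add: sum.distrib add_mult_distrib2)
  finally show ?thesis
    unfolding expand[of ?u] expand[of y] long tail by linarith
qed

text \<open>For \<open>q \<le> l\<close> each condition tests a single entry of a column against
  \<open>z\<close>, so permuting columns is harmless. For \<open>l < p\<close> both rows step
  against the same entry of \<open>z\<close>. In between, \<open>x\<close> and \<open>y\<close> meet
  \<open>z\<close> in conditions of different types, and an invariant for crossed columns is
  required.\<close>

lemma compat_swap_above:
  assumes "row_compat (l, z) (p, x)" "row_compat (l, z) (q, y)" "row_compat (p, x) (q, y)" "p < q"
  shows "row_compat (l, z) (q, long_row p x y) \<and> row_compat (l, z) (p, short_row x y)"
proof -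
  let ?u = "long_row p x y" and ?v = "short_row x y"
  have B: "cyc (y j) (y (Suc j)) (x j)" if "j \<le> p" for j
    using assms that by simp
  consider "q \<le> l" | "l < p" | "p \<le> l" "l < q"
    by linarith
  then show ?thesis
  proof cases
    case 1
    with assms show ?thesis
      by (auto simp: long_row_def short_row_def)
  next
    case 2
    have "cyc (?u j) (?u (Suc j)) (z j) \<and> cyc (?v j) (?v (Suc j)) (z j)" if "j \<le> l" for j
    proof -
      have "cyc (x j) (x (Suc j)) (z j)" "cyc (y j) (y (Suc j)) (z j)"
        using assms 2 that by auto
      with 2 that show ?thesis
        using cyc_enter(1,2)[OF B, of j "x (Suc j)" "z j"] cyc_leave(1,2)[OF B, of j "x (Suc j)" "z j"]
          cross_neq[of x y j]
        by (auto simp: long_row_def short_row_def)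
    qed
    with 2 assms(4) show ?thesis
      by auto
  next
    case 3
    have A: "cyc (z j) (z (Suc j)) (x (Suc j))" if "j < p" for j
      using assms 3 that by auto
    have C: "cyc (y j) (y (Suc j)) (z j)" if "j \<le> l" for j
      using assms 3 that by auto
    \<comment> \<open>In a crossed column, going up from \<open>x j\<close>, the entry
      \<open>y j\<close> comes strictly before \<open>z j\<close>.\<close>
    have inv: "cross x y j \<longrightarrow> \<not> cyc (x j) (z j) (y j)" if "j \<le> p" for j
      using that
    proof (induction j)
      case (Suc j)
      then show ?case
        using cyc_enter(7)[OF B _ C A, of j] cyc_cross(6)[OF B _ C _ _ A, of j] cross_neq[of x y j] 3
        by auto
    qed simp
    have "cyc (z j) (z (Suc j)) (?v (Suc j))" if "j < p" for j
      using that inv[of j] A[of j] C[of j] 3 cross_neq[of x y j]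
        cyc_enter(6)[OF B _ C A, of j] cyc_cross(5)[OF B _ C _ _ A, of j]
      by (auto simp: short_row_def)
    moreover have "cyc (?u j) (?u (Suc j)) (z j)" if "j \<le> l" for j
    proof (cases "j \<le> p")
      case True
      with that show ?thesis
        using inv[of j] A[of j] C[of j] 3 cross_neq[of x y j]
          cyc_enter(5)[OF B _ C, of j] cyc_cross(3)[OF B _ C, of j] cyc_cross(4)[OF B _ C, of j]
        by (auto simp: long_row_def)
    next
      case False
      with that C show ?thesis
        by (auto simp: long_row_def)
    qed
    ultimately show ?thesis
      using 3 by auto
  qed
qed

lemma compat_swap_below:
  assumes "row_compat (p, x) (l, z)" "row_compat (q, y) (l, z)" "row_compat (p, x) (q, y)" "p < q"
  shows "row_compat (q, long_row p x y) (l, z) \<and> row_compat (p, short_row x y) (l, z)"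
proof -
  let ?u = "long_row p x y" and ?v = "short_row x y"
  have B: "cyc (y j) (y (Suc j)) (x j)" if "j \<le> p" for j
    using assms that by simp
  consider "q < l" | "l \<le> p" | "p < l" "l \<le> q"
    by linarith
  then show ?thesis
  proof cases
    case 1
    with assms show ?thesis
      by (auto simp: long_row_def short_row_def)
  next
    case 2
    have "cyc (?u j) (?u (Suc j)) (z (Suc j)) \<and> cyc (?v j) (?v (Suc j)) (z (Suc j))" if "j < l" for j
    proof -
      have "cyc (x j) (x (Suc j)) (z (Suc j))" "cyc (y j) (y (Suc j)) (z (Suc j))"
        using assms 2 that by auto
      with 2 that show ?thesis
        using cyc_enter(1,2)[OF B, of j "x (Suc j)" "z (Suc j)"]
          cyc_leave(1,2)[OF B, of j "x (Suc j)" "z (Suc j)"] cross_neq[of x y j]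
        by (auto simp: long_row_def short_row_def)
    qed
    with 2 assms(4) show ?thesis
      by auto
  next
    case 3
    have A: "cyc (y j) (y (Suc j)) (z (Suc j))" if "j < l" for j
      using assms 3 that by auto
    have C: "cyc (z j) (z (Suc j)) (x j)" if "j \<le> p" for j
      using assms 3 that by auto
    \<comment> \<open>The mirrored invariant: \<open>z j\<close> may equal \<open>y j\<close> but
      not \<open>x j\<close>, whereas for a row above the pair it is the other way round.\<close>
    have inv: "cross x y j \<longrightarrow> cyc (x j) (y j) (z j) \<and> z j \<noteq> x j" if "j \<le> p" for j
      using that
    proof (induction j)
      case (Suc j)
      then show ?case
        using cyc_enter(8,9)[OF B _ A, of j] cyc_cross(10,11)[OF B _ _ _ C A, of j]
          cross_neq[of x y j] 3
        by auto
    qed simp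
    have "cyc (z j) (z (Suc j)) (?v j)" if "j \<le> p" for j
      using that inv[of j] C[of j] 3 cross_neq[of x y j] cyc_cross(7)[OF B _ _ _ C, of j]
      by (auto simp: short_row_def)
    moreover have "cyc (?u j) (?u (Suc j)) (z (Suc j))" if "j < l" for j
    proof (cases "j \<le> p")
      case True
      with that show ?thesis
        using inv[of j] A[of j] C[of j] 3 cross_neq[of x y j]
          cyc_enter(5)[OF B _ A, of j] cyc_cross(8)[OF B _ _ _ C A, of j] cyc_cross(9)[OF B _ _ _ C A, of j]
        by (auto simp: long_row_def)
    next
      case False
      with that A show ?thesis
        by (auto simp: long_row_def)
    qed
    ultimately show ?thesis
      using 3 by auto
  qed
qed

section \<open>Moving a longest row to the top\<close>

text \<open>A common basement entry keeps column 0 fixed under exchanges. As an upper bound it plays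
  the role of the right end of the word, where the scan starts.\<close>

fun based :: "'a::linorder \<Rightarrow> 'a row \<Rightarrow> bool" where
  "based t (p, x) \<longleftrightarrow> x 0 = t \<and> (\<forall>j\<le>p. x j \<le> t)"

lemma based_swapped:
  assumes "based t (p, x)" "based t (q, y)" "p < q"
  shows "based t (q, long_row p x y)" "based t (p, short_row x y)"
  using assms by (auto simp: long_row_def short_row_def)

lemma longest_row_first:
  assumes "sorted_wrt row_compat (us @ R # vs)" "\<forall>S\<in>set (us @ R # vs). based t S \<and> fst S \<le> fst R"
  shows "\<exists>R' vs'. sorted_wrt row_compat (R' # vs') \<and> (\<forall>S\<in>set (R' # vs'). based t S \<and> fst S \<le> fst R') \<and>
    length vs' = length us + length vs \<and>
    sum_list (map cells (R' # vs')) = sum_list (map cells (us @ R # vs)) \<and>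
    sum_list (map row_maj (R' # vs')) = sum_list (map row_maj (us @ R # vs))"
  using assms
proof (induction us arbitrary: R vs rule: rev_induct)
  case Nil
  then show ?case
    by (intro exI[of _ R] exI[of _ vs]) auto
next
  case (snoc S us)
  obtain p x q y where S: "S = (p, x)" and R: "R = (q, y)"
    by (cases S; cases R)
  show ?case
  proof (cases "p < q")
    \<comment> \<open>Now \<open>p = q\<close>, so \<open>S\<close> is itself a longest row and
      moves on upwards in place of \<open>R\<close>.\<close>
    case False
    have "sorted_wrt row_compat (us @ S # R # vs)"
      "\<forall>T\<in>set (us @ S # R # vs). based t T \<and> fst T \<le> fst S"
      using snoc.prems False by (auto simp: S R)
    from snoc.IH[OF this] show ?thesis
      by simp
  next
    case True
    let ?R = "(q, long_row p x y)" and ?S = "(p, short_row x y)"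
    have compat: "row_compat S R" "sorted_wrt row_compat us" "sorted_wrt row_compat vs"
      "\<And>z. z \<in> set us \<Longrightarrow> row_compat z S \<and> row_compat z R"
      "\<And>z. z \<in> set vs \<Longrightarrow> row_compat S z \<and> row_compat R z"
      "\<And>z w. z \<in> set us \<Longrightarrow> w \<in> set vs \<Longrightarrow> row_compat z w"
      using snoc.prems(1) by (auto simp: sorted_wrt_append)
    have above: "row_compat z ?R \<and> row_compat z ?S" if "z \<in> set us" for z
    proof (cases z)
      case (Pair l w)
      show ?thesis
        using compat_swap_above[of l w p x q y] compat(1) compat(4)[OF that] True unfolding Pair S R by blast
    qed
    have below: "row_compat ?R z \<and> row_compat ?S z" if "z \<in> set vs" for z
    proof (cases z)
      case (Pair l w)
      show ?thesis
        using compat_swap_below[of p x l w q y] compat(1) compat(5)[OF that] True unfolding Pair S R by blast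
    qed
    have "row_compat ?R ?S"
      using compat_swapped[OF True] .
    hence compat': "sorted_wrt row_compat (us @ ?R # ?S # vs)"
      using compat above below by (auto simp: sorted_wrt_append simp del: row_compat.simps)
    have based': "\<forall>T\<in>set (us @ ?R # ?S # vs). based t T \<and> fst T \<le> fst ?R"
      using snoc.prems(2) True based_swapped[of t p x q y] by (auto simp: S R simp del: based.simps)
    have "cells ?R + (cells ?S + M) = cells S + (cells R + M)" for M
      using cells_swapped[OF True, of x y] unfolding S R by (metis add.assoc)
    hence cells': "sum_list (map cells (us @ ?R # ?S # vs)) = sum_list (map cells ((us @ [S]) @ R # vs))"
      by (simp del: cells.simps)
    have "row_maj ?R + (row_maj ?S + k) = row_maj S + (row_maj R + k)" for k
      using row_maj_swapped[of p x q y] compat(1) True unfolding S R by simp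
    hence maj': "sum_list (map row_maj (us @ ?R # ?S # vs)) = sum_list (map row_maj ((us @ [S]) @ R # vs))"
      by (simp del: row_maj.simps)
    have length': "length us + length (?S # vs) = length (us @ [S]) + length vs"
      by simp
    show ?thesis
      using snoc.IH[OF compat' based'] unfolding cells' maj' length' .
  qed
qed

subsection \<open>Standard subwords\<close>

lemma sum_single_mset: "finite A \<Longrightarrow> (\<Sum>a\<in>A. {#g a#}) = image_mset g (mset_set A)"
  by (induction A rule: finite_induct) auto

lemma cells_eq_image_mset: "cells (p, x) = image_mset (\<lambda>j. (x j, j)) (mset_set {1..p})"
  by (simp add: sum_single_mset)

lemma mset_nths: "mset (nths xs I) = (\<Sum>i\<in>{i. i < length xs \<and> i \<in> I}. {#xs ! i#})"
proof (induction xs rule: rev_induct)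
  case (snoc x xs)
  have "{i. i < length (xs @ [x]) \<and> i \<in> I} =
      {i. i < length xs \<and> i \<in> I} \<union> (if length xs \<in> I then {length xs} else {})"
    by (auto simp: less_Suc_eq)
  with snoc show ?case
    by (simp add: nths_append nth_append sum.insert_if)
qed simp

lemma mset_nths_compl: "mset (nths xs I) + mset (nths xs (- I)) = mset xs"
proof (induction xs arbitrary: I)
  case (Cons x xs)
  have "{j. Suc j \<notin> I} = - {j. Suc j \<in> I}"
    by auto
  with Cons[of "{j. Suc j \<in> I}"] show ?case
    by (auto simp: nths_Cons)
qed simp

lemma sorted_wrt_nths: "sorted_wrt P xs \<Longrightarrow> sorted_wrt P (nths xs I)"
  by (induction xs arbitrary: I) (auto simp: nths_Cons dest: in_set_nthsD)

text \<open>The term \<open>a j\<close> occurs for \<open>r = j + 1, ..., m\<close>; this turns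
  cocharge indices into leg weights.\<close>

lemma sum_partial_sums:
  fixes a :: "nat \<Rightarrow> nat"
  shows "(\<Sum>r = 1..m. \<Sum>j<r. a j) = (\<Sum>j<m. (m - j) * a j)"
proof (induction m)
  case (Suc m)
  have "(\<Sum>j<Suc m. (Suc m - j) * a j) = (\<Sum>j<Suc m. (m - j) * a j + a j)"
    by (rule sum.cong) (auto simp: Suc_diff_le)
  with Suc show ?case
    by (simp add: sum.distrib)
qed simp

text \<open>Entries decrease along the array and ties are listed by increasing column, so
  \<open>Suc i\<close> stands left of \<open>i\<close> exactly at a strict ascent. The index of a
  letter thus counts the ascents before it.\<close>

lemma cocharge_perm_row:
  assumes "mset M = cells (m, f)" "sorted_wrt array_le M" "m \<ge> 1 \<Longrightarrow> f 1 \<le> f 0"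
  shows "cocharge_perm (map snd M) = row_maj (m, f)"
proof -
  have set: "set M = (\<lambda>j. (f j, j)) ` {1..m}"
    using assms(1) unfolding cells_eq_image_mset by (metis finite_atLeastAtMost finite_set_mset_mset_set set_image_mset set_mset_mset)
  have len: "length M = m"
    using assms(1) unfolding cells_eq_image_mset by (metis card_atLeastAtMost diff_Suc_1 size_image_mset size_mset size_mset_set)
  have left: "left_of (map snd M) (Suc i) i \<longleftrightarrow> f i < f (Suc i)" if "1 \<le> i" "i < m" for i
  proof
    assume "left_of (map snd M) (Suc i) i"
    then obtain p q where pq: "p < q" "q < length M" "snd (M ! p) = Suc i" "snd (M ! q) = i"
      by (auto simp: left_of_def)
    have "M ! p = (f (Suc i), Suc i)" "M ! q = (f i, i)"
      using pq nth_mem[of p M] nth_mem[of q M] by (auto simp: set)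
    with pq sorted_wrt_nth_less[OF assms(2), of p q] show "f i < f (Suc i)"
      by (auto simp: array_le_def)
  next
    assume less: "f i < f (Suc i)"
    have "(f (Suc i), Suc i) \<in> set M" "(f i, i) \<in> set M"
      using that by (auto simp: set)
    then obtain p q where pq: "p < length M" "M ! p = (f (Suc i), Suc i)" "q < length M" "M ! q = (f i, i)"
      by (metis in_set_conv_nth)
    have "p < q"
    proof (rule ccontr)
      assume "\<not> p < q"
      with pq have "q < p"
        by (metis Pair_inject n_not_Suc_n nat_neq_iff)
      with sorted_wrt_nth_less[OF assms(2), of q p] pq less show False
        by (auto simp: array_le_def)
    qed
    with pq show "left_of (map snd M) (Suc i) i"
      unfolding left_of_def by (metis length_map nth_map snd_conv)
  qed
  have index: "cocharge_index (map snd M) r = (\<Sum>j<r. asc (f j) (f (Suc j)))" if "r \<le> m" for r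
    using that
  proof (induction r)
    case (Suc r)
    show ?case
    proof (cases r)
      \<comment> \<open>The only term compares \<open>f 1\<close> with the basement
        \<open>f 0\<close>, and this is no ascent.\<close>
      case 0
      with assms(3) Suc.prems show ?thesis
        by simp
    next
      case (Suc i)
      with Suc.IH Suc.prems left[of r] show ?thesis
        by (simp del: sum_of_bool_eq)
    qed
  qed simp
  have "cocharge_perm (map snd M) = (\<Sum>r = 1..m. \<Sum>j<r. asc (f j) (f (Suc j)))"
    unfolding cocharge_perm_def using index len by (intro sum.cong) auto
  thus ?thesis
    unfolding sum_partial_sums by simp
qed

text \<open>A scan stops at the rightmost admissible position. Entries decrease to the right, so it
  finds the smallest entry.\<close>

lemma nth_Max_sorted:
  assumes "sorted_wrt array_le L" "Q \<subseteq> {..<length L}" "q \<in> Q" "L ! q = (v, k)"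
    "\<And>q'. q' \<in> Q \<Longrightarrow> snd (L ! q') = k \<and> v \<le> fst (L ! q')"
  shows "Max Q < length L" "L ! Max Q = (v, k)"
proof -
  have fin: "finite Q"
    using assms(2) finite_subset by blast
  hence Max: "Max Q \<in> Q" "q \<le> Max Q"
    using assms(3) Max_in[OF fin] Max_ge[OF fin] by blast+
  show "Max Q < length L"
    using Max assms(2) by auto
  show "L ! Max Q = (v, k)"
  proof (cases "q = Max Q")
    case False
    with Max sorted_wrt_nth_less[OF assms(1), of q "Max Q"] \<open>Max Q < length L\<close>
    have "array_le (v, k) (L ! Max Q)"
      using assms(4) by simp
    with assms(5)[OF Max(1)] show ?thesis
      by (cases "L ! Max Q") (auto simp: array_le_def)
  qed (use assms(4) in simp)
qed

text \<open>Scanning leftwards means going up in value, and wrapping around means passing the top,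
  so the scan finds the cyclically next entry of each column.\<close>

lemma std_pos_row:
  assumes sorted: "sorted_wrt array_le L"
    and row: "\<And>j. 1 \<le> j \<Longrightarrow> j \<le> m \<Longrightarrow> (f j, j) \<in> set L"
    and cyc: "\<And>c i. (c, Suc i) \<in> set L \<Longrightarrow> cyc (f i) (f (Suc i)) c"
    and top: "\<And>c j. (c, j) \<in> set L \<Longrightarrow> c \<le> f 0"
    and "i < m"
  shows "std_pos (map snd L) (Suc i) < length L \<and> L ! std_pos (map snd L) (Suc i) = (f (Suc i), Suc i)"
  using \<open>i < m\<close>
proof (induction i)
  case 0
  let ?Q = "{q. q < length L \<and> map snd L ! q = 1}"
  have "(f 1, 1) \<in> set L"
    using row 0 by simp
  then obtain q where q: "q < length L" "L ! q = (f 1, 1)"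
    by (metis in_set_conv_nth)
  have "f 1 \<le> fst (L ! q')" if "q' \<in> ?Q" for q'
  proof -
    from that have "(fst (L ! q'), Suc 0) \<in> set L"
      by (auto simp: in_set_conv_nth intro!: exI[of _ q'] prod_eqI)
    from cyc[OF this] top[OF this] top[OF \<open>(f 1, 1) \<in> set L\<close>] show ?thesis
      by (auto simp: cyc_def)
  qed
  hence "Max ?Q < length L" "L ! Max ?Q = (f 1, 1)"
    using q by (intro nth_Max_sorted[OF sorted, of _ q]; auto)+
  moreover have "std_pos (map snd L) (Suc 0) = Max ?Q"
    using q by (auto simp: scan_left_def)
  ultimately show ?case
    by simp
next
  case (Suc i)
  let ?w = "map snd L" and ?v = "f (Suc (Suc i))"
  define p where "p = std_pos ?w (Suc i)"
  have p: "p < length L" "L ! p = (f (Suc i), Suc i)"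
    using Suc by (auto simp: p_def)
  have "(?v, Suc (Suc i)) \<in> set L"
    using row Suc by simp
  then obtain q where q: "q < length L" "L ! q = (?v, Suc (Suc i))"
    by (metis in_set_conv_nth)
  have column: "cyc (f (Suc i)) ?v (fst (L ! q'))" if "q' < length L" "?w ! q' = Suc (Suc i)" for q'
    using that by (intro cyc) (auto simp: in_set_conv_nth intro!: exI[of _ q'] prod_eqI)
  \<comment> \<open>Strict, since among equal entries the smaller column stands first; this matches
    \<open>cyc\<close>, which meets its starting value last.\<close>
  have before: "f (Suc i) < fst (L ! q')" if "q' < p" "?w ! q' = Suc (Suc i)" for q'
    using sorted_wrt_nth_less[OF sorted, of q' p] p that by (auto simp: array_le_def split: prod.splits)
  have step: "std_pos ?w (Suc (Suc i)) = scan_left ?w p (Suc (Suc i))"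
    by (simp add: p_def)
  show ?case
  proof (cases "f (Suc i) < ?v")
    case True
    let ?Q = "{q \<in> {..<p}. ?w ! q = Suc (Suc i)}"
    have "q < p"
    proof (rule ccontr)
      assume "\<not> q < p"
      with p q have "p < q"
        by (metis Pair_inject n_not_Suc_n nat_neq_iff)
      with sorted_wrt_nth_less[OF sorted, of p q] p q True show False
        by (auto simp: array_le_def)
    qed
    with q p have "q \<in> ?Q"
      by simp
    moreover have "?v \<le> fst (L ! q')" if "q' \<in> ?Q" for q'
      using column[of q'] before[of q'] that True p by (auto simp: cyc_def)
    ultimately have "Max ?Q < length L" "L ! Max ?Q = (?v, Suc (Suc i))"
      using q p by (intro nth_Max_sorted[OF sorted, of _ q]; auto)+
    moreover have "scan_left ?w p (Suc (Suc i)) = Max ?Q"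
      using \<open>q \<in> ?Q\<close> by (auto simp: scan_left_def)
    ultimately show ?thesis
      unfolding step by simp
  next
    \<comment> \<open>The whole column lies weakly below \<open>f (Suc i)\<close>, so nothing is
      left of \<open>p\<close> and the scan wraps.\<close>
    case False
    let ?Q = "{q \<in> {..<length ?w}. ?w ! q = Suc (Suc i)}"
    have le: "?v \<le> fst (L ! q') \<and> fst (L ! q') \<le> f (Suc i)" if "q' \<in> ?Q" for q'
      using column[of q'] that False by (auto simp: cyc_def)
    hence "Max ?Q < length L" "L ! Max ?Q = (?v, Suc (Suc i))"
      using q by (intro nth_Max_sorted[OF sorted, of _ q]; auto)+
    moreover have "\<not> (\<exists>q<p. ?w ! q = Suc (Suc i))"
    proof
      assume "\<exists>q<p. ?w ! q = Suc (Suc i)"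
      then obtain q' where q': "q' < p" "?w ! q' = Suc (Suc i)"
        by blast
      with p have "q' \<in> ?Q"
        by simp
      with before[OF q'] le[of q'] show False
        by (meson leD)
    qed
    hence "scan_left ?w p (Suc (Suc i)) = Max ?Q"
      by (simp only: scan_left_def if_False)
    ultimately show ?thesis
      unfolding step by simp
  qed
qed


text \<open>The bound on the columns makes \<open>m\<close> the largest letter, so the extraction
  ends exactly at the end of the row.\<close>

lemma cocharge_first_row:
  assumes L: "mset L = cells (m, f) + M" "sorted_wrt array_le L"
    and m: "1 \<le> m"
    and columns: "\<And>c j. (c, j) \<in> set L \<Longrightarrow> 1 \<le> j \<and> j \<le> m \<and> c \<le> f 0"
    and cyc: "\<And>c i. (c, Suc i) \<in> set L \<Longrightarrow> cyc (f i) (f (Suc i)) c"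
  obtains L' where "mset L' = M" "sorted_wrt array_le L'"
    "cocharge (map snd L) = row_maj (m, f) + cocharge (map snd L')"
proof -
  let ?w = "map snd L" and ?S = "std_positions (map snd L)"
  have row: "(f j, j) \<in> set L" if "1 \<le> j" "j \<le> m" for j
  proof -
    have "(f j, j) \<in># mset L"
      unfolding L(1) cells_eq_image_mset using that by auto
    thus ?thesis
      by simp
  qed
  have pos: "std_pos ?w j < length L \<and> L ! std_pos ?w j = (f j, j)" if "j \<in> {1..m}" for j
    using std_pos_row[OF L(2) row cyc, of m "j - 1"] columns that by (cases j) auto
  have "1 \<in> set ?w"
    using row[of 1] m by force
  have "Max (set ?w) = m"
  proof (rule Max_eqI)
    show "m \<in> set ?w"
      using row[of m] m by force
  qed (use columns in auto)
  hence S: "?S = std_pos ?w ` {1..m}"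
    by (simp add: std_positions_def)
  have inj: "inj_on (std_pos ?w) {1..m}"
    by (rule inj_onI) (metis pos snd_conv)
  have "{i. i < length L \<and> i \<in> ?S} = std_pos ?w ` {1..m}"
    using pos by (auto simp: S)
  hence "mset (nths L ?S) = (\<Sum>i\<in>std_pos ?w ` {1..m}. {#L ! i#})"
    by (simp add: mset_nths)
  also have "\<dots> = (\<Sum>j\<in>{1..m}. {#L ! std_pos ?w j#})"
    by (subst sum.reindex[OF inj]) simp
  also have "\<dots> = cells (m, f)"
    unfolding cells.simps using pos by (intro sum.cong) auto
  finally have first: "mset (nths L ?S) = cells (m, f)" .
  show thesis
  proof (rule that)
    show "mset (nths L (- ?S)) = M"
      using mset_nths_compl[of L ?S] first L(1) by simp
    show "sorted_wrt array_le (nths L (- ?S))"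
      using L(2) by (rule sorted_wrt_nths)
    have "f 1 \<le> f 0"
      using columns row[of 1] m by auto
    hence "cocharge_perm (map snd (nths L ?S)) = row_maj (m, f)"
      using cocharge_perm_row[OF first sorted_wrt_nths[OF L(2)]] by simp
    thus "cocharge ?w = row_maj (m, f) + cocharge (map snd (nths L (- ?S)))"
      using \<open>1 \<in> set ?w\<close> by (subst cocharge.simps) (simp add: std_subword_def std_remainder_def nths_map)
  qed
qed

section \<open>Induction on the number of rows\<close>

lemma cocharge_rows:
  assumes "sorted_wrt row_compat rows" "\<forall>S\<in>set rows. based t S"
    "mset L = sum_list (map cells rows)" "sorted_wrt array_le L"
  shows "cocharge (map snd L) = sum_list (map row_maj rows)"
  using assms
proof (induction "length rows" arbitrary: rows L)
  case 0
  thus ?case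
    by (simp add: cocharge.simps)
next
  case (Suc k)
  let ?m = "Max (fst ` set rows)"
  have "?m \<in> fst ` set rows"
    using Suc.hyps(2) by (intro Max_in) auto
  then obtain R where R: "R \<in> set rows" "fst R = ?m"
    by auto
  then obtain us vs where rows: "rows = us @ R # vs"
    by (meson split_list)
  have "\<forall>S\<in>set (us @ R # vs). based t S \<and> fst S \<le> fst R"
    using Suc.prems(2) R unfolding rows[symmetric] by auto
  from longest_row_first[OF _ this] Suc.prems(1) obtain R' rest where
    rest: "sorted_wrt row_compat (R' # rest)" "\<forall>S\<in>set (R' # rest). based t S \<and> fst S \<le> fst R'"
    "length rest = length us + length vs"
    "sum_list (map cells (R' # rest)) = sum_list (map cells rows)"
    "sum_list (map row_maj (R' # rest)) = sum_list (map row_maj rows)"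
    unfolding rows by blast
  obtain m f where R': "R' = (m, f)"
    by (cases R')
  have mset_L: "mset L = cells (m, f) + sum_list (map cells rest)"
    using Suc.prems(3) rest(4) by (simp add: R')
  have mem: "\<exists>p x. (p, x) \<in> set (R' # rest) \<and> 1 \<le> j \<and> j \<le> p \<and> c = x j" if "(c, j) \<in> set L" for c j
  proof -
    have "(c, j) \<in># sum_list (map cells (R' # rest))"
      using that Suc.prems(3) rest(4) by (metis set_mset_mset)
    then obtain S where "S \<in> set (R' # rest)" "(c, j) \<in># cells S"
      unfolding set_mset_sum_list set_map by blast
    moreover obtain p x where "S = (p, x)"
      by (cases S)
    ultimately have "(p, x) \<in> set (R' # rest)" "(c, j) \<in># cells (p, x)"
      by simp_all
    moreover from this(2) have "1 \<le> j \<and> j \<le> p \<and> c = x j"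
      unfolding cells_eq_image_mset by auto
    ultimately show ?thesis
      by blast
  qed
  show ?case
  proof (cases "m = 0")
    \<comment> \<open>All rows are empty; there is no letter 1 to extract and both sides are
      0.\<close>
    case True
    with rest(2) have zero: "fst S = 0" if "S \<in> set (R' # rest)" for S
      using that by (auto simp: R')
    have "(c, j) \<notin> set L" for c j
    proof
      assume "(c, j) \<in> set L"
      from mem[OF this] obtain p x where "(p, x) \<in> set (R' # rest)" "1 \<le> j" "j \<le> p"
        by blast
      with zero[of "(p, x)"] show False
        by simp
    qed
    hence "set L = {}"
      by (auto intro!: equals0I simp del: set_empty)
    moreover have "row_maj S = 0" if "S \<in> set (R' # rest)" for S
      using zero[OF that] by (cases S) simp
    hence "sum_list (map row_maj (R' # rest)) = 0"
      by (simp add: sum_list_eq_0_iff del: row_maj.simps)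
    ultimately show ?thesis
      unfolding rest(5) by (simp add: cocharge.simps del: sum_list_eq_0_iff)
  next
    case False
    have columns: "1 \<le> j \<and> j \<le> m \<and> c \<le> f 0" if cj: "(c, j) \<in> set L" for c j
    proof -
      obtain p x where "(p, x) \<in> set (R' # rest)" "1 \<le> j" "j \<le> p" "c = x j"
        using mem[OF cj] by blast
      with rest(2) show ?thesis
        by (fastforce simp: R')
    qed
    \<comment> \<open>Against the other rows a longest first row has type A conditions only; against
      itself this is \<open>cyc_refl\<close>.\<close>
    have cyc: "cyc (f i) (f (Suc i)) c" if ci: "(c, Suc i) \<in> set L" for c i
    proof -
      obtain p x where px: "(p, x) \<in> set (R' # rest)" "Suc i \<le> p" "c = x (Suc i)"
        using mem[OF ci] by blast
      with rest(2) have "p \<le> m"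
        by (fastforce simp: R')
      with px rest(1) show ?thesis
        by (auto simp: R')
    qed
    obtain L' where L': "mset L' = sum_list (map cells rest)" "sorted_wrt array_le L'"
      "cocharge (map snd L) = row_maj (m, f) + cocharge (map snd L')"
      using False cocharge_first_row[OF mset_L Suc.prems(4) _ columns cyc] by auto
    have "cocharge (map snd L') = sum_list (map row_maj rest)"
      using Suc.hyps rest L' by (intro Suc.hyps(1)) (auto simp: rows)
    with L'(3) rest(5) show ?thesis
      by (simp add: R')
  qed
qed

subsection \<open>Inversion-free fillings\<close>

lemma ex_rotate3: "(\<exists>i. P (rotate i [a, b, c])) \<longleftrightarrow> P [a, b, c] \<or> P [b, c, a] \<or> P [c, a, b]"
proof
  assume "\<exists>i. P (rotate i [a, b, c])"
  then obtain i where "P (rotate i [a, b, c])" ..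
  hence "P (rotate (i mod 3) [a, b, c])"
    using rotate_conv_mod[of i "[a, b, c]"] by simp
  moreover have "i mod 3 = 0 \<or> i mod 3 = 1 \<or> i mod 3 = 2"
    by presburger
  ultimately show "P [a, b, c] \<or> P [b, c, a] \<or> P [c, a, b]"
    by (auto simp: numeral_2_eq_2)
next
  have "rotate 0 [a, b, c] = [a, b, c]" "rotate 1 [a, b, c] = [b, c, a]" "rotate 2 [a, b, c] = [c, a, b]"
    by (simp_all add: numeral_2_eq_2)
  moreover assume "P [a, b, c] \<or> P [b, c, a] \<or> P [c, a, b]"
  ultimately show "\<exists>i. P (rotate i [a, b, c])"
    by metis
qed

text \<open>\<open>(a, c, b)\<close> and \<open>(c, b, a)\<close> are rotations of each other, so
  both types give the same condition. The tie priorities become the weak and strict inequalities of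
  \<open>cyc\<close>.\<close>

lemma inversion_typeA_iff: "inversion_typeA F (a, b, c) \<longleftrightarrow> \<not> cyc (F a) (F b) (F c)"
  unfolding inversion_typeA_def prod.case ex_rotate3 by (auto simp: cyc_def)

lemma inversion_typeB_iff: "inversion_typeB F (a, b, c) \<longleftrightarrow> \<not> cyc (F a) (F b) (F c)"
  unfolding inversion_typeB_def prod.case ex_rotate3 by (auto simp: cyc_def)

lemma cocharge_ccw_inv_free:
  assumes F: "F \<in> inv_free n \<alpha> \<sigma>"
  shows "cocharge (ccw n \<alpha> F) = maj n \<alpha> F"
proof -
  \<comment> \<open>With a common basement entry the type B conditions on column 1 become void.\<close>
  define x where "x r j = (if j = 0 then Infty 0 else F (r, j))" for r j
  define rows where "rows = map (\<lambda>r. (\<alpha> r, x r)) [1..<Suc n]"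
  have num: "\<exists>k. F (r, j) = Num k" if "r \<in> {1..n}" "1 \<le> j" "j \<le> \<alpha> r" for r j
  proof -
    have "(r, j) \<in> diagram n \<alpha>"
      using that by (simp add: diagram_def aug_diagram_def)
    with F show ?thesis
      unfolding inv_free_def fillings_def by blast
  qed
  have basement: "F (r, 0) = Infty (\<sigma> r)" if "r \<in> {1..n}" for r
    using F that by (auto simp: inv_free_def fillings_def)
  have A: "cyc (F (r, j)) (F (r, Suc j)) (F (k, Suc j))"
    if "r \<in> {1..n}" "k \<in> {1..n}" "r < k" "\<alpha> k \<le> \<alpha> r" "j < \<alpha> k" for r k j
  proof -
    have "((r, Suc j - 1), (r, Suc j), (k, Suc j)) \<in> typeA_triples n \<alpha>"
      unfolding typeA_triples_def
      by (intro CollectI, rule exI[of _ r], rule exI[of _ k], rule exI[of _ "Suc j"])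
        (use that in \<open>auto simp: aug_diagram_def\<close>)
    hence "\<not> inversion_typeA F ((r, Suc j - 1), (r, Suc j), (k, Suc j))"
      using F unfolding inv_free_def by blast
    thus ?thesis
      by (simp add: inversion_typeA_iff)
  qed
  have B: "cyc (F (k, j)) (F (k, Suc j)) (F (r, j))"
    if "r \<in> {1..n}" "k \<in> {1..n}" "r < k" "\<alpha> r < \<alpha> k" "j \<le> \<alpha> r" for r k j
  proof -
    have "((k, Suc j - 1), (k, Suc j), (r, Suc j - 1)) \<in> typeB_triples n \<alpha>"
      unfolding typeB_triples_def
      by (intro CollectI, rule exI[of _ k], rule exI[of _ r], rule exI[of _ "Suc j"])
        (use that in \<open>auto simp: aug_diagram_def\<close>)
    hence "\<not> inversion_typeB F ((k, Suc j - 1), (k, Suc j), (r, Suc j - 1))"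
      using F unfolding inv_free_def by blast
    thus ?thesis
      by (simp add: inversion_typeB_iff)
  qed
  have "row_compat (\<alpha> r, x r) (\<alpha> k, x k)" if rk: "r \<in> {1..n}" "k \<in> {1..n}" "r < k" for r k
  proof (cases "\<alpha> k \<le> \<alpha> r")
    case True
    have "cyc (x r j) (x r (Suc j)) (x k (Suc j))" if j: "j < \<alpha> k" for j
    proof (cases j)
      \<comment> \<open>Any basement entry exceeds all numbers, so changing it does not affect the
        comparison.\<close>
      case 0
      obtain u v where "F (r, Suc 0) = Num u" "F (k, Suc 0) = Num v"
        using num[of r "Suc 0"] num[of k "Suc 0"] rk j True by auto
      then show ?thesis
        using A[OF rk True j] basement[OF rk(1)] 0 by (auto simp: x_def cyc_def less_eq_entry_def)
    qed (use A[OF rk True j] in \<open>simp add: x_def\<close>)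
    with True show ?thesis
      by simp
  next
    case False
    have "cyc (x k j) (x k (Suc j)) (x r j)" if j: "j \<le> \<alpha> r" for j
    proof (cases j)
      case 0
      obtain u where "F (k, Suc 0) = Num u"
        using num[of k "Suc 0"] rk False by auto
      then show ?thesis
        using 0 by (auto simp: x_def cyc_def less_eq_entry_def)
    qed (use B[OF rk _ j] False in \<open>simp add: x_def\<close>)
    with False show ?thesis
      by simp
  qed
  hence compat: "sorted_wrt row_compat rows"
    unfolding rows_def sorted_wrt_map
    by (intro sorted_wrt_mono_rel[OF _ sorted_wrt_upt]) (auto simp del: upt_Suc row_compat.simps)
  have "x r j \<le> Infty 0" if "r \<in> {1..n}" "j \<le> \<alpha> r" for r j
    using num[of r j] that by (cases "j = 0") (auto simp: x_def less_eq_entry_def)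
  hence based: "\<forall>S\<in>set rows. based (Infty 0) S"
    by (auto simp: rows_def x_def simp del: upt_Suc)
  have boxes: "diagram n \<alpha> = (SIGMA r:{1..n}. {1..\<alpha> r})"
    by (auto simp: diagram_def aug_diagram_def)
  have sum_rows: "sum_list (map g rows) = (\<Sum>r\<in>{1..n}. g (\<alpha> r, x r))"
    for g :: "entry row \<Rightarrow> 'b::comm_monoid_add"
    unfolding rows_def by (simp add: interv_sum_list_conv_sum_set_nat o_def atLeastLessThanSuc_atLeastAtMost del: upt_Suc)
  have "mset (two_line_array n \<alpha> F) = (\<Sum>(r, j)\<in>diagram n \<alpha>. {#(F (r, j), j)#})"
    unfolding mset_two_line_array boxes by (simp add: sum_single_mset case_prod_unfold)
  also have "\<dots> = (\<Sum>r\<in>{1..n}. cells (\<alpha> r, x r))"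
    unfolding boxes cells.simps by (subst sum.Sigma) (auto simp: x_def intro!: sum.cong)
  finally have mset: "mset (two_line_array n \<alpha> F) = sum_list (map cells rows)"
    unfolding sum_rows .
  have "cocharge (ccw n \<alpha> F) = sum_list (map row_maj rows)"
    unfolding ccw_def by (rule cocharge_rows[OF compat based mset sorted_two_line_array])
  also have "\<dots> = (\<Sum>r\<in>{1..n}. \<Sum>j\<in>{1..\<alpha> r}. (leg \<alpha> (r, j) + 1) * asc (F (r, j - 1)) (F (r, j)))"
    unfolding sum_rows
  proof (rule sum.cong[OF refl])
    fix r assume r: "r \<in> {1..n}"
    have asc: "asc (x r j) (x r (Suc j)) = asc (F (r, j)) (F (r, Suc j))" if "j < \<alpha> r" for j
      using that num[OF r, of 1] basement[OF r] by (cases j) (auto simp: x_def)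
    have "row_maj (\<alpha> r, x r) = (\<Sum>j<\<alpha> r. (leg \<alpha> (r, Suc j) + 1) * asc (F (r, j)) (F (r, Suc j)))"
      unfolding row_maj.simps using asc by (intro sum.cong) (auto simp: leg_def Suc_diff_Suc)
    thus "row_maj (\<alpha> r, x r) = (\<Sum>j\<in>{1..\<alpha> r}. (leg \<alpha> (r, j) + 1) * asc (F (r, j - 1)) (F (r, j)))"
      by (simp add: sum.atLeast1_atMost_eq)
  qed
  also have "\<dots> = (\<Sum>(r, j)\<in>diagram n \<alpha>. (leg \<alpha> (r, j) + 1) * asc (F (r, j - 1)) (F (r, j)))"
    unfolding boxes by (subst sum.Sigma) auto
  also have "\<dots> = maj n \<alpha> F"
    unfolding maj_def boxes by (rule sum.mono_neutral_cong_right) auto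
  finally show ?thesis .
qed

theorem theorem5p10:
  fixes n :: nat and lam :: "nat \<Rightarrow> nat" and \<tau> :: "nat \<Rightarrow> nat" and F :: "box \<Rightarrow> entry"
  assumes partition: "\<forall>i j. 1 \<le> i \<and> i \<le> j \<and> j \<le> n \<longrightarrow> lam j \<le> lam i"
    and perm: "\<tau> permutes {1..n}"
    and F: "F \<in> inv_free n (perm_act \<tau> lam) (perm_act \<tau> (w0 n))"
  shows "cocharge (ccw n (perm_act \<tau> lam) F) = maj n (perm_act \<tau> lam) F"
  using F by (rule cocharge_ccw_inv_free)

end
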